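(* Consider an instance of the tour budgeted prize-collecting covering subgraph problem on a graph $G=(V,E)$ with edge costs $\ell_e\ge 0$ (as defined in the context). Let $T$ be an optimal tour and let $v_1,v_2,v_3,v_4\in V$ be four distinct vertices visited by $T$, such that all the edges $e_{ij}=\{v_i,v_j\}$ connecting them, namely $e_{12},e_{13},e_{14},e_{23},e_{24},e_{34}$, are in $E$. Suppose that $$\ell_{e_{12}}+\ell_{e_{34}}>\ell_{e_{13}}+\ell_{e_{24}}\qquad\text{and}\qquad \ell_{e_{12}}+\ell_{e_{34}}>\ell_{e_{23}}+\ell_{e_{14}}.$$ Then there exists an optimal tour $T'$ that does not contain both the edges $e_{12}$ and $e_{34}$ (i.e. $\{e_{12},e_{34}\}\not\subseteq T'$), and such that $$T\setminus\{e_{12},e_{13},e_{14},e_{23},e_{24},e_{34}\}=T'\setminus\{e_{12},e_{13},e_{14},e_{23},e_{24},e_{34}\}.$$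
   Context: Instance. $G=(V,E)$ is a finite simple undirected graph with a distinguished vertex $0\in V$ (the depot). Given are a budget $L>0$; a cost $\ell_e\ge 0$ for each $e\in E$; for each $v\in V$ a neighbourhood $N_v\subseteq V\setminus\{v\}$ (the set of vertices that can cover $v$; it is not necessarily the graph neighbourhood); a coverage capacity $c_v$ (a nonnegative integer) for each $v\in V$; a prize $p_v\ge 0$ earned by visiting $v$, for each $v\in V$; and a prize $q_{vw}\ge 0$ earned by covering $v$ via $w$, for each $v\in V\setminus\{0\}$ and $w\in N_v$. Feasible tours. A tour is identified with its edge set $T\subseteq E$. It is the edge set of a simple cycle of $G$ passing through the depot: the graph formed by the edges of $T$ and their endpoints is connected, contains $0$, and every vertex in it has degree exactly $2$. The vertices visited by $T$ are the vertices of this cycle; let $V(T)$ denote this set. $T$ is a feasible tour if in addition $\sum_{e\in T}\ell_e\le L$. Coverage. Given the set $V(T)$ of visited vertices, a coverage assignment assigns to some of the unvisited vertices $v\in V\setminus V(T)$ a single visited vertex $w\in N_v\cap V(T)$ (then $v$ is said to be covered by $w$), such that each visited vertex $w$ covers at most $c_w$ vertices. Each unvisited vertex is covered by at most one visited vertex, and visited vertices are not covered. Objective. The collected prize is the sum of $p_v$ over all visited vertices $v\neq 0$ plus the sum of $q_{vw}$ over all pairs such that $v$ is covered by $w$. A feasible tour $T$ is optimal if, with a best coverage assignment, its collected prize is maximum among all feasible tours and coverage assignments. *)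

theory Defs
  imports Complex_Main
begin

text \<open>An undirected edge is a two-element set of vertices.\<close>

record 'v tour_instance =
  verts    :: "'v set"
  edges    :: "'v set set"
  depot    :: 'v
  budget   :: real
  cost     :: "'v set \<Rightarrow> real"
  nbhd     :: "'v \<Rightarrow> 'v set"
  capacity :: "'v \<Rightarrow> nat"
  vprize   :: "'v \<Rightarrow> real"
  cprize   :: "'v \<Rightarrow> 'v \<Rightarrow> real"

text \<open>\<open>nbhd I v\<close> is the set of vertices that can cover \<open>v\<close>; \<open>cprize I v w\<close> is the prize for
  covering \<open>v\<close> via \<open>w\<close>.\<close>

definition wf_instance :: "'v tour_instance \<Rightarrow> bool" where
  "wf_instance I \<longleftrightarrow>
     finite (verts I) \<and>
     (\<forall>e \<in> edges I. e \<subseteq> verts I \<and> card e = 2) \<and>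
     depot I \<in> verts I \<and>
     budget I > 0 \<and>
     (\<forall>e \<in> edges I. cost I e \<ge> 0) \<and>
     (\<forall>v \<in> verts I. nbhd I v \<subseteq> verts I - {v}) \<and>
     (\<forall>v \<in> verts I. vprize I v \<ge> 0) \<and>
     (\<forall>v \<in> verts I - {depot I}. \<forall>w \<in> nbhd I v. cprize I v w \<ge> 0)"

text \<open>The graph formed by an edge set \<open>T\<close> has vertex set \<open>\<Union>T\<close>.\<close>

definition visited :: "'v set set \<Rightarrow> 'v set" where
  "visited T = \<Union>T"

definition edge_degree :: "'v set set \<Rightarrow> 'v \<Rightarrow> nat" where
  "edge_degree T v = card {e \<in> T. v \<in> e}"

definition edges_connected :: "'v set set \<Rightarrow> bool" where
  "edges_connected T \<longleftrightarrow>
     (\<forall>u \<in> visited T. \<forall>v \<in> visited T. (u, v) \<in> {(x, y). {x, y} \<in> T}\<^sup>*)"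

definition is_tour :: "'v tour_instance \<Rightarrow> 'v set set \<Rightarrow> bool" where
  "is_tour I T \<longleftrightarrow>
     T \<subseteq> edges I \<and>
     edges_connected T \<and>
     depot I \<in> visited T \<and>
     (\<forall>v \<in> visited T. edge_degree T v = 2)"

definition feasible_tour :: "'v tour_instance \<Rightarrow> 'v set set \<Rightarrow> bool" where
  "feasible_tour I T \<longleftrightarrow> is_tour I T \<and> (\<Sum>e\<in>T. cost I e) \<le> budget I"

text \<open>A coverage assignment is a partial map: \<open>f v = Some w\<close> means that \<open>v\<close> is covered by \<open>w\<close>.\<close>

definition coverage_assignment ::
    "'v tour_instance \<Rightarrow> 'v set set \<Rightarrow> ('v \<rightharpoonup> 'v) \<Rightarrow> bool" where
  "coverage_assignment I T f \<longleftrightarrow>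
     dom f \<subseteq> verts I - visited T \<and>
     (\<forall>v w. f v = Some w \<longrightarrow> w \<in> nbhd I v \<inter> visited T) \<and>
     (\<forall>w \<in> visited T. card {v. f v = Some w} \<le> capacity I w)"

definition collected_prize ::
    "'v tour_instance \<Rightarrow> 'v set set \<Rightarrow> ('v \<rightharpoonup> 'v) \<Rightarrow> real" where
  "collected_prize I T f =
     (\<Sum>v \<in> visited T - {depot I}. vprize I v) + (\<Sum>v \<in> dom f. cprize I v (the (f v)))"

definition optimal_tour :: "'v tour_instance \<Rightarrow> 'v set set \<Rightarrow> bool" where
  "optimal_tour I T \<longleftrightarrow>
     feasible_tour I T \<and>
     (\<exists>f. coverage_assignment I T f \<and>
        (\<forall>T' f'. feasible_tour I T' \<longrightarrow> coverage_assignment I T' f' \<longrightarrow>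
           collected_prize I T' f' \<le> collected_prize I T f))"

end

theory Submission
  imports Defs
begin

text \<open>
  If \<open>T\<close> misses one of \<open>{v1, v2}\<close>, \<open>{v3, v4}\<close>, it is its own witness. Otherwise the witness is a
  2-opt move: delete these two edges and reconnect the remainder \<open>R\<close> crosswise, by
  \<open>{v1, v4}, {v2, v3}\<close> or by \<open>{v1, v3}, {v2, v4}\<close>. Both choices are strictly cheaper, so the budget
  still holds, and they leave the visited vertices unchanged; as coverage assignments and prizes
  depend on a tour only through its visited vertices, optimality is inherited.

  It remains to see that one of the two reconnections is again a single cycle. In \<open>R\<close> the vertices
  \<open>v1, \<dots>, v4\<close> have degree 1 and all others have even degree, so by the handshake lemma every
  connected component of \<open>R\<close> contains an even number of the four (\<open>even_card_odd_degree\<close>). The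
  component of \<open>v1\<close> cannot contain just \<open>v1\<close> and \<open>v2\<close>, since both deleted edges would then stay
  within components and \<open>T\<close> would be disconnected. Hence \<open>R\<close> links \<open>v1\<close> to \<open>v3\<close> and \<open>v2\<close> to \<open>v4\<close>, or
  \<open>v1\<close> to \<open>v4\<close> and \<open>v2\<close> to \<open>v3\<close> (\<open>crosswise_links\<close>). In either case adding the pair of edges that
  runs between the two links gives a cycle (\<open>single_cycle_exchange\<close>).
\<close>

section \<open>Links in an edge set\<close>

definition linked :: "'v set set \<Rightarrow> ('v \<times> 'v) set" where
  "linked R = {(x, y). {x, y} \<in> R}\<^sup>*"

lemma linked_refl [simp]: "(x, x) \<in> linked R"
  by (simp add: linked_def)

lemma linked_edge: "{x, y} \<in> R \<Longrightarrow> (x, y) \<in> linked R"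
  by (auto simp: linked_def)

lemma linked_trans: "(x, y) \<in> linked R \<Longrightarrow> (y, z) \<in> linked R \<Longrightarrow> (x, z) \<in> linked R"
  unfolding linked_def by (rule rtrancl_trans)

lemma linked_sym: "(x, y) \<in> linked R \<Longrightarrow> (y, x) \<in> linked R"
proof -
  have "sym {(x, y). {x, y} \<in> R}"
    by (auto simp: sym_def insert_commute)
  then show "(x, y) \<in> linked R \<Longrightarrow> (y, x) \<in> linked R"
    unfolding linked_def by (meson sym_rtrancl symD)
qed

lemma linked_mono: "R \<subseteq> S \<Longrightarrow> (x, y) \<in> linked R \<Longrightarrow> (x, y) \<in> linked S"
  unfolding linked_def by (rule subsetD[OF rtrancl_mono]) auto

lemma linked_stays_in_closed_set:
  assumes "(x, y) \<in> linked R" "x \<in> C" "\<And>u w. {u, w} \<in> R \<Longrightarrow> u \<in> C \<Longrightarrow> w \<in> C"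
  shows "y \<in> C"
  using assms(1) unfolding linked_def
  by (induction rule: rtrancl_induct) (use assms(2,3) in auto)

lemma edges_connected_iff_linked:
  "edges_connected T \<longleftrightarrow> (\<forall>u \<in> visited T. \<forall>v \<in> visited T. (u, v) \<in> linked T)"
  by (simp add: edges_connected_def linked_def)

section \<open>Degrees and parity\<close>

lemma edge_degree_insert:
  assumes "finite R" "e \<notin> R"
  shows "edge_degree (insert e R) v = edge_degree R v + (if v \<in> e then 1 else 0)"
proof -
  have "{f \<in> insert e R. v \<in> f} = (if v \<in> e then insert e {f \<in> R. v \<in> f} else {f \<in> R. v \<in> f})"
    by auto
  then show ?thesis
    using assms by (simp add: edge_degree_def)
qed

text \<open>Two vertices of degree 1 that are joined by an edge form a component of their own.\<close>

lemma linked_isolated_edge: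
  assumes "{x, y} \<in> R" "edge_degree R x = 1" "edge_degree R y = 1" "(x, z) \<in> linked R"
  shows "z = x \<or> z = y"
proof -
  have only: "e = {x, y}" if "e \<in> R" "t \<in> e" "t \<in> {x, y}" for e t
  proof -
    have "card {e \<in> R. t \<in> e} = 1"
      using assms(2,3) that(3) by (auto simp: edge_degree_def)
    moreover have "e \<in> {e \<in> R. t \<in> e}" "{x, y} \<in> {e \<in> R. t \<in> e}"
      using that assms(1) by auto
    ultimately show ?thesis
      by (metis card_1_singletonE singletonD)
  qed
  have "w \<in> {x, y}" if "{u, w} \<in> R" "u \<in> {x, y}" for u w
    using only[of "{u, w}" u] that by blast
  then have "z \<in> {x, y}"
    using linked_stays_in_closed_set[OF assms(4), of "{x, y}"] by blast
  then show ?thesis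
    by simp
qed

text \<open>
  The handshake lemma on a union \<open>C\<close> of components: every edge that meets \<open>C\<close> lies inside \<open>C\<close> and so
  contributes 2 to the sum of the degrees over \<open>C\<close>.
\<close>

lemma even_card_odd_degree:
  assumes "finite R" "finite C" "\<And>e. e \<in> R \<Longrightarrow> card e = 2"
    and closed: "\<And>u w. {u, w} \<in> R \<Longrightarrow> u \<in> C \<Longrightarrow> w \<in> C"
  shows "even (card {v \<in> C. odd (edge_degree R v)})"
proof -
  have "even (card {v \<in> C. v \<in> e})" if e: "e \<in> R" for e
  proof -
    obtain x y where xy: "e = {x, y}" "x \<noteq> y"
      using assms(3)[OF e] by (auto simp: card_2_iff)
    have "x \<in> C \<longleftrightarrow> y \<in> C"
      using closed[of x y] closed[of y x] e xy by (auto simp: insert_commute)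
    then have "{v \<in> C. v \<in> e} = (if x \<in> C then {x, y} else {})"
      using xy by auto
    then show ?thesis
      using xy(2) by simp
  qed
  then have "even (\<Sum>e\<in>R. card {v \<in> C. v \<in> e})"
    by (simp add: dvd_sum)
  also have "(\<Sum>e\<in>R. card {v \<in> C. v \<in> e}) = (\<Sum>v\<in>C. edge_degree R v)"
    unfolding edge_degree_def
    using sum.swap_restrict[OF assms(1,2), of "\<lambda>_ _. 1 :: nat" "\<lambda>e v. v \<in> e"] by simp
  finally show ?thesis
    using even_sum_iff[OF assms(2), of "edge_degree R"] by simp
qed

section \<open>Exchanging two edges of a cycle\<close>

definition single_cycle :: "'v set set \<Rightarrow> bool" where
  "single_cycle T \<longleftrightarrow> finite T \<and> (\<forall>e \<in> T. card e = 2) \<and> edges_connected T \<and>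
     (\<forall>v \<in> visited T. edge_degree T v = 2)"

lemma edge_degree_delete_two:
  assumes "single_cycle T" "{a, b} \<in> T" "{c, d} \<in> T" "distinct [a, b, c, d]"
  shows "edge_degree (T - {{a, b}, {c, d}}) v =
     (if v \<in> {a, b, c, d} then 1 else if v \<in> visited T then 2 else 0)"
proof -
  let ?R = "T - {{a, b}, {c, d}}"
  have "T = insert {a, b} (insert {c, d} ?R)" "{a, b} \<noteq> {c, d}"
    using assms by (auto simp: doubleton_eq_iff)
  then have "edge_degree T v = edge_degree ?R v + (if v \<in> {c, d} then 1 else 0)
      + (if v \<in> {a, b} then 1 else 0)"
    using assms(1) edge_degree_insert[of "insert {c, d} ?R" "{a, b}" v]
      edge_degree_insert[of ?R "{c, d}" v]
    by (simp add: single_cycle_def)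
  moreover have "edge_degree T v = (if v \<in> visited T then 2 else 0)"
  proof (cases "v \<in> visited T")
    case False
    then have "{e \<in> T. v \<in> e} = {}"
      by (auto simp: visited_def)
    then show ?thesis
      using False by (metis card.empty edge_degree_def)
  qed (use assms(1) in \<open>simp add: single_cycle_def\<close>)
  moreover have "v \<in> {a, b, c, d} \<Longrightarrow> v \<in> visited T"
    using assms(2,3) by (auto simp: visited_def)
  ultimately show ?thesis
    using assms(4) by (auto split: if_splits)
qed

text \<open>
  By parity, \<open>a\<close> and \<open>b\<close> each have a partner among the four vertices. They cannot have only each
  other, as \<open>T\<close> is connected; and if they lie in different components, their partners differ.
\<close>

lemma crosswise_links:
  assumes "single_cycle T" "{a, b} \<in> T" "{c, d} \<in> T" "distinct [a, b, c, d]"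
  defines "R \<equiv> T - {{a, b}, {c, d}}"
  shows "(a, c) \<in> linked R \<and> (b, d) \<in> linked R \<or> (a, d) \<in> linked R \<and> (b, c) \<in> linked R"
proof -
  have fin: "finite R" and card2: "\<And>e. e \<in> R \<Longrightarrow> card e = 2"
    using assms(1) by (auto simp: single_cycle_def R_def)
  have finV: "finite (visited T)"
    using assms(1) unfolding visited_def single_cycle_def
    by (intro finite_Union) (auto intro: card_ge_0_finite)
  have inV: "a \<in> visited T" "b \<in> visited T" "c \<in> visited T" "d \<in> visited T"
    using assms(2,3) by (auto simp: visited_def)
  have parity: "even (card {v \<in> {a, b, c, d}. (x, v) \<in> linked R})" for x
  proof -
    let ?C = "{v \<in> visited T. (x, v) \<in> linked R}"
    have "w \<in> ?C" if "{u, w} \<in> R" "u \<in> ?C" for u w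
      using that linked_edge[of u w R] linked_trans[of x u R w]
      by (auto simp: R_def visited_def)
    then have "even (card {v \<in> ?C. odd (edge_degree R v)})"
      using even_card_odd_degree[of R ?C] fin finV card2 by auto
    moreover have "{v \<in> ?C. odd (edge_degree R v)} = {v \<in> {a, b, c, d}. (x, v) \<in> linked R}"
      using edge_degree_delete_two[OF assms(1-4)] inV by (auto simp: R_def split: if_splits)
    ultimately show ?thesis
      by metis
  qed
  have count: "card {v \<in> {a, b, c, d}. P v} =
      of_bool (P a) + of_bool (P b) + of_bool (P c) + of_bool (P d)" for P
  proof -
    have "card {v \<in> {a, b, c, d}. P v} = (\<Sum>v\<in>{a, b, c, d}. of_bool (P v))"
      by (simp add: Int_def)
    then show ?thesis
      using assms(4) by simp
  qed
  have even_links: "((x, a) \<in> linked R \<longleftrightarrow> (x, b) \<in> linked R) \<longleftrightarrow>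
      ((x, c) \<in> linked R \<longleftrightarrow> (x, d) \<in> linked R)" for x
    using parity[of x] unfolding count by (simp add: of_bool_def split: if_splits)
  have not_just_b: "(a, c) \<in> linked R \<or> (a, d) \<in> linked R"
  proof (rule ccontr)
    assume none: "\<not> ?thesis"
    then have ab: "(a, b) \<in> linked R"
      using even_links[of a] by simp
    let ?C = "{v. (a, v) \<in> linked R}"
    \<comment> \<open>The component of \<open>a\<close> in \<open>R\<close> absorbs \<open>{a, b}\<close> and misses \<open>{c, d}\<close>, so not even \<open>T\<close> leaves it.\<close>
    have "w \<in> ?C" if "{u, w} \<in> T" "u \<in> ?C" for u w
    proof (cases "{u, w} \<in> R")
      case True
      then show ?thesis
        using that(2) linked_trans linked_edge by fast
    next
      case False
      then have "{u, w} = {a, b} \<or> {u, w} = {c, d}"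
        using that(1) by (auto simp: R_def)
      then show ?thesis
        using that(2) none ab by (auto simp: doubleton_eq_iff)
    qed
    moreover have "(a, c) \<in> linked T"
      using assms(1) inV by (auto simp: single_cycle_def edges_connected_iff_linked)
    ultimately have "c \<in> ?C"
      using linked_stays_in_closed_set[of a c T ?C] by simp
    then show False
      using none by simp
  qed
  show ?thesis
  proof (cases "(a, b) \<in> linked R")
    case True
    \<comment> \<open>By parity \<open>R\<close> links all four vertices. Counting edges would exclude this, but here both
      alternatives of the claim simply hold.\<close>
    then have "(a, c) \<in> linked R" "(a, d) \<in> linked R"
      using even_links[of a] not_just_b by auto
    then show ?thesis
      using True linked_sym linked_trans by fast
  next
    case False
    then have "(b, a) \<notin> linked R"
      using linked_sym by fast
    then have "(b, c) \<in> linked R \<or> (b, d) \<in> linked R"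
      using even_links[of b] by auto
    moreover have "\<not> ((a, z) \<in> linked R \<and> (b, z) \<in> linked R)" for z
      using False linked_sym linked_trans by fast
    ultimately show ?thesis
      using not_just_b by blast
  qed
qed

text \<open>
  The new edges are indeed new: \<open>a\<close> and \<open>d\<close> have degree 1 in the remainder, so an old edge \<open>{a, d}\<close>
  would be a component and cut \<open>a\<close> off from \<open>c\<close>; likewise for \<open>{b, c}\<close>. So every vertex regains the
  degree it lost. Every vertex of the cycle stays linked to one of \<open>a, b, c, d\<close> after the deletion,
  and the new graph chains these four as \<open>b, d, a, c, b\<close>.
\<close>

lemma single_cycle_exchange:
  assumes T: "single_cycle T" "{a, b} \<in> T" "{c, d} \<in> T" "distinct [a, b, c, d]"
  defines "R \<equiv> T - {{a, b}, {c, d}}"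
  assumes links: "(a, c) \<in> linked R" "(b, d) \<in> linked R"
  defines "T' \<equiv> insert {a, d} (insert {b, c} R)"
  shows "{a, d} \<notin> R" "{b, c} \<notin> R" "visited T' = visited T" "single_cycle T'"
proof -
  have deg: "edge_degree R v = (if v \<in> {a, b, c, d} then 1 else if v \<in> visited T then 2 else 0)" for v
    using edge_degree_delete_two[OF T] by (simp add: R_def)
  show ad: "{a, d} \<notin> R"
    using linked_isolated_edge[of a d R c] deg links(1) T(4) by auto
  show bc: "{b, c} \<notin> R"
    using linked_isolated_edge[of b c R d] deg links(2) T(4) by auto
  have "T = insert {a, b} (insert {c, d} R)"
    using T(2,3) by (auto simp: R_def)
  then show vis: "visited T' = visited T"
    by (auto simp: T'_def visited_def)
  have fin: "finite R"
    using T(1) by (simp add: R_def single_cycle_def)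
  have "{a, d} \<noteq> {b, c}"
    using T(4) by (auto simp: doubleton_eq_iff)
  then have deg': "edge_degree T' v = 2" if "v \<in> visited T" for v
    using that T(4) ad bc fin by (auto simp: T'_def edge_degree_insert deg)
  have RT': "(x, y) \<in> linked R \<Longrightarrow> (x, y) \<in> linked T'" for x y
    by (rule linked_mono) (auto simp: T'_def)
  have a_to_all: "(a, z) \<in> linked T'" if "z \<in> {a, b, c, d}" for z
  proof -
    have "(a, c) \<in> linked T'" "(a, d) \<in> linked T'" "(d, b) \<in> linked T'"
      using RT'[OF links(1)] linked_sym[OF RT'[OF links(2)]] linked_edge[of a d T']
      by (auto simp: T'_def)
    then show ?thesis
      using that linked_trans by fastforce
  qed
  have a_to_visited: "(a, u) \<in> linked T'" if "u \<in> visited T" for u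
  proof -
    let ?C = "{u. \<exists>z \<in> {a, b, c, d}. (z, u) \<in> linked R}"
    have ends: "{a, b, c, d} \<subseteq> ?C"
      using linked_refl by fast
    have "y \<in> ?C" if "{x, y} \<in> T" "x \<in> ?C" for x y
    proof (cases "{x, y} \<in> R")
      case True
      then show ?thesis
        using that(2) linked_trans linked_edge by fast
    next
      case False
      then have "{x, y} = {a, b} \<or> {x, y} = {c, d}"
        using that(1) by (auto simp: R_def)
      then have "y \<in> {a, b, c, d}"
        by (auto simp: doubleton_eq_iff)
      then show ?thesis
        using ends by (rule subsetD[rotated])
    qed
    moreover have "a \<in> visited T"
      using T(2) by (auto simp: visited_def)
    then have "(a, u) \<in> linked T"
      using T(1) that by (auto simp: single_cycle_def edges_connected_iff_linked)
    ultimately have "u \<in> ?C"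
      using linked_stays_in_closed_set[of a u T ?C] ends by blast
    then show ?thesis
      using a_to_all RT' linked_trans by fast
  qed
  have "edges_connected T'"
    unfolding edges_connected_iff_linked vis
    using a_to_visited linked_sym linked_trans by fast
  moreover have "finite T'" "\<forall>e \<in> T'. card e = 2"
    using T(1,4) by (auto simp: single_cycle_def T'_def R_def)
  ultimately show "single_cycle T'"
    using deg' vis by (simp add: single_cycle_def)
qed

section \<open>The exchange preserves optimality\<close>

lemma optimal_tour_same_visited:
  assumes "optimal_tour I T" "feasible_tour I T'" "visited T' = visited T"
  shows "optimal_tour I T'"
  using assms by (simp add: optimal_tour_def coverage_assignment_def collected_prize_def)

lemma single_cycle_of_is_tour:
  assumes "wf_instance I" "is_tour I T"
  shows "single_cycle T"
proof -
  have "edges I \<subseteq> Pow (verts I)" "finite (verts I)"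
    using assms(1) by (auto simp: wf_instance_def)
  then have "finite (edges I)"
    by (meson finite_Pow_iff finite_subset)
  then show ?thesis
    using assms by (auto simp: single_cycle_def is_tour_def wf_instance_def intro: finite_subset)
qed

lemma optimal_tour_exchange:
  assumes "wf_instance I" "optimal_tour I T" "{a, b} \<in> T" "{c, d} \<in> T" "distinct [a, b, c, d]"
    and "{a, d} \<in> edges I" "{b, c} \<in> edges I"
    and cheaper: "cost I {a, d} + cost I {b, c} \<le> cost I {a, b} + cost I {c, d}"
  defines "R \<equiv> T - {{a, b}, {c, d}}"
  assumes "(a, c) \<in> linked R" "(b, d) \<in> linked R"
  shows "optimal_tour I (insert {a, d} (insert {b, c} R))"
proof -
  let ?T' = "insert {a, d} (insert {b, c} R)"
  have tour: "is_tour I T" and budget: "sum (cost I) T \<le> budget I"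
    using assms(2) by (auto simp: optimal_tour_def feasible_tour_def)
  note cyc = single_cycle_of_is_tour[OF assms(1) tour]
  note ex = single_cycle_exchange[OF cyc assms(3-5), folded R_def, OF assms(10,11)]
  have T_eq: "T = insert {a, b} (insert {c, d} R)"
    and distinct_edges: "{a, b} \<noteq> {c, d}" "{a, d} \<noteq> {b, c}"
    using assms(3-5) by (auto simp: R_def doubleton_eq_iff)
  have "finite R"
    using cyc by (simp add: R_def single_cycle_def)
  moreover have "{a, b} \<notin> R" "{c, d} \<notin> R"
    by (auto simp: R_def)
  ultimately have "sum (cost I) T = cost I {a, b} + cost I {c, d} + sum (cost I) R"
    "sum (cost I) ?T' = cost I {a, d} + cost I {b, c} + sum (cost I) R"
    using ex(1,2) distinct_edges by (simp_all add: T_eq)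
  then have "sum (cost I) ?T' \<le> budget I"
    using budget cheaper by simp
  moreover have "is_tour I ?T'"
    using tour ex(3,4) assms(6,7) by (auto simp: is_tour_def single_cycle_def R_def)
  ultimately show ?thesis
    using optimal_tour_same_visited[OF assms(2) _ ex(3)] by (simp add: feasible_tour_def)
qed

theorem proposition5p1:
  fixes I :: "'v tour_instance" and T :: "'v set set" and v1 v2 v3 v4 :: 'v
  assumes "wf_instance I"
    and "optimal_tour I T"
    and "v1 \<in> visited T" "v2 \<in> visited T" "v3 \<in> visited T" "v4 \<in> visited T"
    and "distinct [v1, v2, v3, v4]"
    and "{v1, v2} \<in> edges I" "{v1, v3} \<in> edges I" "{v1, v4} \<in> edges I"
        "{v2, v3} \<in> edges I" "{v2, v4} \<in> edges I" "{v3, v4} \<in> edges I"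
    and "cost I {v1, v2} + cost I {v3, v4} > cost I {v1, v3} + cost I {v2, v4}"
    and "cost I {v1, v2} + cost I {v3, v4} > cost I {v2, v3} + cost I {v1, v4}"
  shows "\<exists>T'. optimal_tour I T' \<and>
           \<not> {{v1, v2}, {v3, v4}} \<subseteq> T' \<and>
           T - {{v1, v2}, {v1, v3}, {v1, v4}, {v2, v3}, {v2, v4}, {v3, v4}} =
           T' - {{v1, v2}, {v1, v3}, {v1, v4}, {v2, v3}, {v2, v4}, {v3, v4}}"
proof (cases "{{v1, v2}, {v3, v4}} \<subseteq> T")
  case False
  then show ?thesis
    using assms(2) by blast
next
  case True
  then have e12: "{v1, v2} \<in> T" and e34: "{v3, v4} \<in> T"
    by auto
  have e43: "{v4, v3} \<in> T"
    using e34 by (simp add: insert_commute)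
  let ?R = "T - {{v1, v2}, {v3, v4}}"
  have cyc: "single_cycle T"
    using single_cycle_of_is_tour assms(1,2) by (auto simp: optimal_tour_def feasible_tour_def)
  consider "(v1, v3) \<in> linked ?R" "(v2, v4) \<in> linked ?R"
    | "(v1, v4) \<in> linked ?R" "(v2, v3) \<in> linked ?R"
    using crosswise_links[OF cyc e12 e34 assms(7)] by blast
  then show ?thesis
  proof cases
    case 1
    have "optimal_tour I (insert {v1, v4} (insert {v2, v3} ?R))"
      by (rule optimal_tour_exchange[OF assms(1,2) e12 e34 assms(7)])
        (use 1 assms(8-15) in auto)
    moreover have "{v1, v2} \<notin> insert {v1, v4} (insert {v2, v3} ?R)"
      using assms(7) by (auto simp: doubleton_eq_iff)
    ultimately show ?thesis
      by (intro exI[of _ "insert {v1, v4} (insert {v2, v3} ?R)"]) auto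
  next
    \<comment> \<open>The same exchange with \<open>v3\<close> and \<open>v4\<close> interchanged.\<close>
    case 2
    have "optimal_tour I (insert {v1, v3} (insert {v2, v4} (T - {{v1, v2}, {v4, v3}})))"
      by (rule optimal_tour_exchange[OF assms(1,2) e12 e43])
        (use 2 assms(7-15) in \<open>auto simp: insert_commute\<close>)
    then have "optimal_tour I (insert {v1, v3} (insert {v2, v4} ?R))"
      by (simp add: insert_commute)
    moreover have "{v1, v2} \<notin> insert {v1, v3} (insert {v2, v4} ?R)"
      using assms(7) by (auto simp: doubleton_eq_iff)
    ultimately show ?thesis
      by (intro exI[of _ "insert {v1, v3} (insert {v2, v4} ?R)"]) auto
  qed
qed

end
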